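(* Let $\mathbb K$ be a discrete field, $V$ a locally linearly compact $\mathbb K$-vector space and $f\colon V\to V$ a continuous endomorphism. Let $\Phi=\mathcal{LCO}^{\wedge}(f)\colon \mathcal{LCO}^\wedge(V)\to\mathcal{LCO}^\wedge(V)$ be the map $U\mapsto U\cap f^{-1}(U)$. Then $$\mathrm{ent}^*(f)=\widetilde h\big((\mathcal{LCO}^{\wedge}(V),d^*_{\dim}),\Phi\big).$$
   Context: A topological $\mathbb K$-vector space $V$ is linearly compact if it is Hausdorff with a neighborhood basis at $0$ consisting of linear subspaces, and any collection of closed linear varieties (closed cosets of linear subspaces) of $V$ with the finite intersection property has non-empty intersection. A topological $\mathbb K$-vector space $V$ is locally linearly compact if the family $\mathcal{LCO}(V)$ of all linearly compact open linear subspaces of $V$ is a neighborhood basis at $0$. Topological entropy: for a continuous endomorphism $f$ of a locally linearly compact $\mathbb K$-vector space $V$ and $U\in\mathcal{LCO}(V)$, $$\mathrm{ent}^*(f,U)=\lim_{n\to\infty}\frac1n\dim\frac{U}{U\cap f^{-1}(U)\cap\dots\cap f^{-n+1}(U)},$$ where $f^{-k}(U)=(f^k)^{-1}(U)$ (the limit exists), and $\mathrm{ent}^*(f)=\sup\{\mathrm{ent}^*(f,U)\mid U\in\mathcal{LCO}(V)\}$. $\mathcal{LCO}^{\wedge}(V)=\mathcal{LCO}(V)\cup\{V\}$, ordered by inverse inclusion, is a join-semilattice whose join is $H\cap H'$ and whose bottom element is $V$, endowed with the generalized quasimetric $d^*_{\dim}(H,H')=\dim_{\mathbb K}(H/(H\cap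 H'))\in\mathbb R_{\ge0}\cup\{\infty\}$ (equal to $\infty$ if the dimension is infinite). For a join-semilattice $S$ (join $+$, bottom $0$) with generalized quasimetric $d$ and a semilattice endomorphism $\phi\colon S\to S$: $x\in S$ is $\phi$-inert if $d(x,\phi(x))<\infty$; $\mathcal I_\phi(S)$ is the set of $\phi$-inert elements; $T_n(\phi,x)=x+\phi(x)+\dots+\phi^{n-1}(x)$ for $n\ge1$; $\widetilde h(\phi,x)=\lim_{n\to\infty}\frac{d(x,T_n(\phi,x))}{n}$ for $x\in\mathcal I_\phi(S)$; and the intrinsic semilattice entropy is $\widetilde h((S,d),\phi)=\sup\{\widetilde h(\phi,x)\mid x\in\mathcal I_\phi(S)\}$. (Here the operation $+$ is $\cap$.) *)

theory Defs
  imports "HOL-Analysis.Analysis" "HOL-Library.Set_Algebras"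
begin

section \<open>Dimension of a quotient space\<close>

definition quotient_space :: "'v::ab_group_add set \<Rightarrow> 'v set \<Rightarrow> 'v set set" where
  "quotient_space U W = (\<lambda>u. (+) u ` W) ` U"

text \<open>
  The linear combination of the cosets in \<open>F\<close> with coefficients \<open>c\<close>. Sums of sets are
  elementwise. The summand \<open>W\<close> (the zero of the quotient) is what makes the empty combination and
  zero coefficients come out right, since \<open>smul 0 ` A = {0}\<close>; see \<open>quot_lincomb_coset\<close> below.
\<close>
definition quot_lincomb ::
    "('k::field \<Rightarrow> 'v::ab_group_add \<Rightarrow> 'v) \<Rightarrow> 'v set \<Rightarrow> 'v set set \<Rightarrow> ('v set \<Rightarrow> 'k) \<Rightarrow> 'v set" where
  "quot_lincomb smul W F c = W + (\<Sum>A\<in>F. smul (c A) ` A)"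

definition quot_basis ::
    "('k::field \<Rightarrow> 'v::ab_group_add \<Rightarrow> 'v) \<Rightarrow> 'v set \<Rightarrow> 'v set \<Rightarrow> 'v set set \<Rightarrow> bool" where
  "quot_basis smul U W B \<longleftrightarrow>
     B \<subseteq> quotient_space U W \<and>
     (\<forall>F c. finite F \<and> F \<subseteq> B \<and> quot_lincomb smul W F c = W \<longrightarrow> (\<forall>A\<in>F. c A = 0)) \<and>
     (\<forall>X\<in>quotient_space U W. \<exists>F c. finite F \<and> F \<subseteq> B \<and> X = quot_lincomb smul W F c)"

definition quot_dim ::
    "('k::field \<Rightarrow> 'v::ab_group_add \<Rightarrow> 'v) \<Rightarrow> 'v set \<Rightarrow> 'v set \<Rightarrow> enat" where
  "quot_dim smul U W =
     (if \<exists>B. finite B \<and> quot_basis smul U W B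
      then enat (card (SOME B. finite B \<and> quot_basis smul U W B)) else \<infinity>)"

lemma quot_lincomb_coset:
  assumes "vector_space smul" and W: "module.subspace smul W" and "finite F"
    and r: "\<And>A. A \<in> F \<Longrightarrow> A = (+) (r A) ` W"
  shows "quot_lincomb smul W F c = (+) (\<Sum>A\<in>F. smul (c A) (r A)) ` W"
proof -
  interpret vector_space smul by fact
  show ?thesis
    using \<open>finite F\<close> r
  proof (induction F)
    case empty
    show ?case by (simp add: quot_lincomb_def)
  next
    case (insert A F)
    let ?s = "\<Sum>A\<in>F. smul (c A) (r A)"
    have A: "A = (+) (r A) ` W" by (rule insert.prems) simp
    have IH: "quot_lincomb smul W F c = (+) ?s ` W"
      by (rule insert.IH) (rule insert.prems, simp)
    have "quot_lincomb smul W (insert A F) c = smul (c A) ` A + quot_lincomb smul W F c"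
      using insert.hyps by (simp add: quot_lincomb_def ac_simps)
    also have "\<dots> = smul (c A) ` ((+) (r A) ` W) + (+) ?s ` W"
      by (subst A, subst IH) (rule refl)
    also have "\<dots> = (+) (smul (c A) (r A) + ?s) ` W"
    proof (intro set_eqI iffI)
      fix x assume "x \<in> smul (c A) ` ((+) (r A) ` W) + (+) ?s ` W"
      then obtain w w' where w: "w \<in> W" "w' \<in> W" "x = smul (c A) (r A + w) + (?s + w')"
        unfolding set_plus_def by blast
      have "smul (c A) w + w' \<in> W" using w W by (simp add: subspace_add subspace_scale)
      moreover have "x = (smul (c A) (r A) + ?s) + (smul (c A) w + w')"
        using w by (simp add: scale_right_distrib ac_simps)
      ultimately show "x \<in> (+) (smul (c A) (r A) + ?s) ` W" by blast
    next
      fix x assume "x \<in> (+) (smul (c A) (r A) + ?s) ` W"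
      then obtain w where w: "w \<in> W" "x = smul (c A) (r A + 0) + (?s + w)"
        by (auto simp: add.assoc)
      moreover have "0 \<in> W" using W by (rule subspace_0)
      ultimately show "x \<in> smul (c A) ` ((+) (r A) ` W) + (+) ?s ` W"
        unfolding set_plus_def by blast
    qed
    finally show ?case using insert.hyps by simp
  qed
qed


section \<open>Linearly compact and locally linearly compact spaces\<close>

text \<open>Scalar multiplication is jointly continuous, the field carrying the discrete topology.\<close>
definition topological_vector_space_discrete ::
    "('k::field \<Rightarrow> 'v::topological_ab_group_add \<Rightarrow> 'v) \<Rightarrow> bool" where
  "topological_vector_space_discrete smul \<longleftrightarrow>
     vector_space smul \<and>
     continuous_map (prod_topology (discrete_topology UNIV) euclidean) euclidean
       (\<lambda>(c, v). smul c v)"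

definition closed_linear_variety ::
    "('k::field \<Rightarrow> 'v::topological_ab_group_add \<Rightarrow> 'v) \<Rightarrow> 'v set \<Rightarrow> 'v set \<Rightarrow> bool" where
  "closed_linear_variety smul W C \<longleftrightarrow>
     closedin (top_of_set W) C \<and>
     (\<exists>v\<in>W. \<exists>L\<subseteq>W. module.subspace smul L \<and> C = (+) v ` L)"

text \<open>
  Linear compactness of a linear subspace \<open>W\<close>, regarded as a topological vector space
  with the subspace topology.
\<close>
definition linearly_compact ::
    "('k::field \<Rightarrow> 'v::topological_ab_group_add \<Rightarrow> 'v) \<Rightarrow> 'v set \<Rightarrow> bool" where
  "linearly_compact smul W \<longleftrightarrow>
     module.subspace smul W \<and>
     Hausdorff_space (top_of_set W) \<and>
     neighbourhood_base_at 0 (module.subspace smul) (top_of_set W) \<and>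
     (\<forall>\<C>. (\<forall>C\<in>\<C>. closed_linear_variety smul W C) \<and>
          (\<forall>\<F>. finite \<F> \<and> \<F> \<subseteq> \<C> \<longrightarrow> W \<inter> \<Inter>\<F> \<noteq> {}) \<longrightarrow> W \<inter> \<Inter>\<C> \<noteq> {})"

definition LCO :: "('k::field \<Rightarrow> 'v::topological_ab_group_add \<Rightarrow> 'v) \<Rightarrow> 'v set set" where
  "LCO smul = {U. linearly_compact smul U \<and> open U}"

definition locally_linearly_compact ::
    "('k::field \<Rightarrow> 'v::topological_ab_group_add \<Rightarrow> 'v) \<Rightarrow> bool" where
  "locally_linearly_compact smul \<longleftrightarrow>
     topological_vector_space_discrete smul \<and>
     neighbourhood_base_at 0 (\<lambda>U. U \<in> LCO smul) euclidean"


section \<open>Topological entropy\<close>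

definition ent_star_at ::
    "('k::field \<Rightarrow> 'v::topological_ab_group_add \<Rightarrow> 'v) \<Rightarrow> ('v \<Rightarrow> 'v) \<Rightarrow> 'v set \<Rightarrow> ennreal" where
  "ent_star_at smul f U =
     lim (\<lambda>n. ennreal_of_enat (quot_dim smul U (U \<inter> (\<Inter>k\<in>{1..<n}. (f ^^ k) -` U))) / of_nat n)"

definition ent_star ::
    "('k::field \<Rightarrow> 'v::topological_ab_group_add \<Rightarrow> 'v) \<Rightarrow> ('v \<Rightarrow> 'v) \<Rightarrow> ennreal" where
  "ent_star smul f = (SUP U\<in>LCO smul. ent_star_at smul f U)"


section \<open>Intrinsic semilattice entropy\<close>

text \<open>The data of a join-semilattice with bottom element and generalized quasimetric.\<close>
record 'a qm_semilattice =
  elems :: "'a set"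
  join :: "'a \<Rightarrow> 'a \<Rightarrow> 'a"
  bottom :: 'a
  qdist :: "'a \<Rightarrow> 'a \<Rightarrow> ennreal"

text \<open>
  \<open>\<phi>\<close>-trajectories. For \<open>n = 0\<close> this is the empty join, i.e. the bottom element.
\<close>
primrec trajectory ::
    "('a, 'b) qm_semilattice_scheme \<Rightarrow> ('a \<Rightarrow> 'a) \<Rightarrow> nat \<Rightarrow> 'a \<Rightarrow> 'a" where
  "trajectory S \<phi> 0 x = bottom S"
| "trajectory S \<phi> (Suc n) x = join S (trajectory S \<phi> n x) ((\<phi> ^^ n) x)"

definition inert_elems :: "('a, 'b) qm_semilattice_scheme \<Rightarrow> ('a \<Rightarrow> 'a) \<Rightarrow> 'a set" where
  "inert_elems S \<phi> = {x \<in> elems S. qdist S x (\<phi> x) < \<infinity>}"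

definition intrinsic_entropy_at ::
    "('a, 'b) qm_semilattice_scheme \<Rightarrow> ('a \<Rightarrow> 'a) \<Rightarrow> 'a \<Rightarrow> ennreal" where
  "intrinsic_entropy_at S \<phi> x = lim (\<lambda>n. qdist S x (trajectory S \<phi> n x) / of_nat n)"

definition intrinsic_entropy :: "('a, 'b) qm_semilattice_scheme \<Rightarrow> ('a \<Rightarrow> 'a) \<Rightarrow> ennreal" where
  "intrinsic_entropy S \<phi> = (SUP x\<in>inert_elems S \<phi>. intrinsic_entropy_at S \<phi> x)"

definition LCO_wedge ::
    "('k::field \<Rightarrow> 'v::topological_ab_group_add \<Rightarrow> 'v) \<Rightarrow> 'v set qm_semilattice" where
  "LCO_wedge smul =
     \<lparr>elems = LCO smul \<union> {UNIV},
      join = (\<inter>),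
      bottom = UNIV,
      qdist = (\<lambda>H H'. ennreal_of_enat (quot_dim smul H (H \<inter> H')))\<rparr>"

definition LCO_wedge_map :: "('v \<Rightarrow> 'v) \<Rightarrow> 'v set \<Rightarrow> 'v set" where
  "LCO_wedge_map f U = U \<inter> f -` U"

lemma LCO_wedge_map_elems:
  fixes smul :: "'k::field \<Rightarrow> 'v::topological_ab_group_add \<Rightarrow> 'v"
  assumes lc: "locally_linearly_compact smul" and lin: "Vector_Spaces.linear smul smul f"
    and cont: "continuous_on UNIV f" and U: "U \<in> elems (LCO_wedge smul)"
  shows "LCO_wedge_map f U \<in> elems (LCO_wedge smul)"
proof (cases "U = UNIV")
  case True
  then show ?thesis by (simp add: LCO_wedge_map_def LCO_wedge_def)
next
  case False
  interpret Vector_Spaces.linear smul smul f by fact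
  let ?W = "U \<inter> f -` U"
  have lcU: "linearly_compact smul U" and oU: "open U"
    using U False by (auto simp: LCO_wedge_def LCO_def)
  have sU: "vs1.subspace U" using lcU by (simp add: linearly_compact_def)
  have sW: "vs1.subspace ?W"
    using sU by (auto simp: vs1.subspace_def add scale zero)
  have oW: "open ?W"
    using oU cont by (simp add: open_Int open_vimage)
  have top: "top_of_set ?W = subtopology (top_of_set U) ?W"
    by (simp add: subtopology_subtopology Int_absorb1)
  have haus: "Hausdorff_space (top_of_set ?W)"
  proof -
    have "Hausdorff_space (top_of_set U)" using lcU by (simp add: linearly_compact_def)
    then show ?thesis unfolding top by (rule Hausdorff_space_subtopology)
  qed
  have base: "neighbourhood_base_at 0 vs1.subspace (top_of_set ?W)"
    unfolding neighbourhood_base_at_def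
  proof (intro allI impI)
    fix X assume "openin (top_of_set ?W) X \<and> 0 \<in> X"
    then have X: "open X" "0 \<in> X" "X \<subseteq> ?W" using oW by (auto simp: openin_open_eq)
    then have "openin (top_of_set U) X" using oU by (auto simp: openin_open_eq)
    then obtain A B where AB: "openin (top_of_set U) A" "vs1.subspace B" "0 \<in> A" "A \<subseteq> B" "B \<subseteq> X"
    proof -
      have "neighbourhood_base_at 0 vs1.subspace (top_of_set U)"
        using lcU by (simp add: linearly_compact_def)
      with \<open>openin (top_of_set U) X\<close> X(2) show ?thesis
        using that unfolding neighbourhood_base_at_def by blast
    qed
    then have "openin (top_of_set ?W) A" using X oU oW by (auto simp: openin_open_eq)
    with AB show "\<exists>A B. openin (top_of_set ?W) A \<and> vs1.subspace B \<and> 0 \<in> A \<and> A \<subseteq> B \<and> B \<subseteq> X"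
      by blast
  qed
  have trans: "open ((+) u ` X)" if "open X" for u and X :: "'v set"
  proof -
    have "(+) u ` X = (\<lambda>x. - u + x) -` X" by (force simp: image_iff)
    moreover have "continuous_on UNIV (\<lambda>x. - u + x)" by (intro continuous_intros)
    ultimately show ?thesis using that by (simp add: open_vimage)
  qed
  have clW: "closedin (top_of_set U) ?W"
  proof -
    have "open ((+) u ` ?W)" for u
      using oW by (rule trans)
    then have "open (\<Union>u\<in>U - ?W. (+) u ` ?W)" by blast
    moreover have "U - ?W = (\<Union>u\<in>U - ?W. (+) u ` ?W)"
    proof (intro set_eqI iffI)
      fix x assume "x \<in> U - ?W"
      then show "x \<in> (\<Union>u\<in>U - ?W. (+) u ` ?W)"
        using vs1.subspace_0[OF sW] by (auto intro!: bexI[of _ x] image_eqI[of _ _ 0])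
    next
      fix x assume "x \<in> (\<Union>u\<in>U - ?W. (+) u ` ?W)"
      then obtain u w where uw: "u \<in> U - ?W" "w \<in> ?W" "x = u + w" by blast
      have "x \<in> U" using uw vs1.subspace_add[OF sU] by auto
      moreover have "x \<notin> ?W"
        using uw vs1.subspace_diff[OF sW, of x w] by auto
      ultimately show "x \<in> U - ?W" by blast
    qed
    ultimately have "open (U - ?W)" by simp
    then show ?thesis using oU by (auto simp: closedin_def openin_open_eq)
  qed
  have compact: "?W \<inter> \<Inter>\<C> \<noteq> {}"
    if C: "\<forall>C\<in>\<C>. closed_linear_variety smul ?W C"
      and F: "\<forall>\<F>. finite \<F> \<and> \<F> \<subseteq> \<C> \<longrightarrow> ?W \<inter> \<Inter>\<F> \<noteq> {}" for \<C>
  proof (cases "\<C> = {}")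
    case True
    then show ?thesis using vs1.subspace_0[OF sW] by auto
  next
    case False
    have sub: "C \<subseteq> ?W" and var: "closed_linear_variety smul U C" if "C \<in> \<C>" for C
    proof -
      have "closed_linear_variety smul ?W C" using C that by (rule bspec)
      then have cl: "closedin (top_of_set ?W) C"
        and coset: "\<exists>v\<in>?W. \<exists>L\<subseteq>?W. vs1.subspace L \<and> C = (+) v ` L"
        unfolding closed_linear_variety_def by (rule conjunct1, rule conjunct2)
      show "C \<subseteq> ?W" using cl by (rule closedin_imp_subset)
      have "closedin (top_of_set U) C" using cl clW by (rule closedin_trans)
      moreover obtain v L where "v \<in> ?W" "L \<subseteq> ?W" "vs1.subspace L" "C = (+) v ` L"
        using coset by (elim bexE exE conjE)
      then have "\<exists>v\<in>U. \<exists>L\<subseteq>U. vs1.subspace L \<and> C = (+) v ` L"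
        by (intro bexI[of _ v] exI[of _ L] conjI) simp_all
      ultimately show "closed_linear_variety smul U C"
        unfolding closed_linear_variety_def by (rule conjI)
    qed
    have fip: "\<forall>\<F>. finite \<F> \<and> \<F> \<subseteq> \<C> \<longrightarrow> U \<inter> \<Inter>\<F> \<noteq> {}"
    proof (intro allI impI)
      fix \<F> assume "finite \<F> \<and> \<F> \<subseteq> \<C>"
      then have "?W \<inter> \<Inter>\<F> \<noteq> {}" by (rule F[THEN spec, THEN mp])
      then show "U \<inter> \<Inter>\<F> \<noteq> {}" by auto
    qed
    have all: "\<forall>\<C>. (\<forall>C\<in>\<C>. closed_linear_variety smul U C) \<and>
        (\<forall>\<F>. finite \<F> \<and> \<F> \<subseteq> \<C> \<longrightarrow> U \<inter> \<Inter>\<F> \<noteq> {}) \<longrightarrow> U \<inter> \<Inter>\<C> \<noteq> {}"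
      using lcU unfolding linearly_compact_def by (elim conjE)
    have "U \<inter> \<Inter>\<C> \<noteq> {}"
      by (rule all[THEN spec, THEN mp]) (intro conjI ballI fip var)
    then obtain x where x: "\<forall>C\<in>\<C>. x \<in> C" by auto
    obtain C where C: "C \<in> \<C>" using False by auto
    have "x \<in> ?W" using x C sub[OF C] by auto
    with x show ?thesis by auto
  qed
  have "linearly_compact smul ?W"
    unfolding linearly_compact_def using sW haus base compact by simp
  then show ?thesis using oW by (simp add: LCO_wedge_map_def LCO_wedge_def LCO_def)
qed

end

theory Submission
  imports Defs
begin

text \<open>
  Both entropies are suprema of limits of one and the same sequence. Write \<open>\<Phi> U\<close> for
  \<open>U \<inter> f -` U\<close>. Then \<open>(\<Phi> ^^ n) U\<close> is the intersection of the preimages of \<open>U\<close> under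
  \<open>f ^^ 0, \<dots>, f ^^ n\<close>; these sets decrease with \<open>n\<close>, so the \<open>n\<close>-th trajectory of \<open>\<Phi>\<close> is the
  intersection of the preimages of \<open>U\<close> under the iterates of order below \<open>n\<close>, which is the set
  whose intersection with \<open>U\<close> defines the topological entropy (\<open>intrinsic_entropy_at_LCO_wedge\<close>).

  It remains to compare the index sets, \<open>LCO smul\<close> and the inert elements of
  \<open>LCO smul \<union> {UNIV}\<close>. The added element \<open>UNIV\<close> is fixed by \<open>\<Phi>\<close>, so it contributes entropy 0,
  which does not change a supremum in \<open>ennreal\<close>. In the other direction, every \<open>U \<in> LCO smul\<close> is inert: by
  continuity \<open>\<Phi> U\<close> is an open subspace of \<open>U\<close>, and an open subspace of a linearly compact space
  has finite codimension (\<open>finite_quot_basis_linearly_compact_open\<close>), because a discrete linearly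
  compact space is finite-dimensional. This is where compactness enters: if a basis of \<open>U\<close> contained
  infinitely many vectors \<open>e\<close> whose coordinate functions vanish on the open subspace, then the
  closed affine hyperplanes "the \<open>e\<close>-coordinate equals 1" would have the finite intersection
  property, and a common point would be a vector with infinitely many non-zero coordinates.
\<close>

text \<open>
  The set \<open>C\<close> is a union of translates of the open neighbourhood \<open>W\<close> of 0. For an open subspace
  \<open>W\<close>, this makes every union of cosets of \<open>W\<close> open; the complement is such a union too, which is
  how level sets of coordinate functions are seen to be closed.
\<close>
lemma open_if_add_stable:
  fixes C W :: "'v::topological_ab_group_add set"
  assumes "open W" "0 \<in> W" and stable: "\<And>x w. x \<in> C \<Longrightarrow> w \<in> W \<Longrightarrow> x + w \<in> C"
  shows "open C"
proof -
  have "open ((\<lambda>y. - x + y) -` W)" for x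
    using \<open>open W\<close> by (intro open_vimage) (auto intro!: continuous_intros)
  then have "open (\<Union>x\<in>C. (\<lambda>y. - x + y) -` W)" by blast
  moreover have "(\<Union>x\<in>C. (\<lambda>y. - x + y) -` W) = C"
  proof (intro set_eqI iffI)
    fix y assume "y \<in> (\<Union>x\<in>C. (\<lambda>y. - x + y) -` W)"
    then obtain x where x: "x \<in> C" "- x + y \<in> W" by auto
    have "y = x + (- x + y)" by simp
    then show "y \<in> C" using stable[OF x] by metis
  next
    fix y assume "y \<in> C"
    then show "y \<in> (\<Union>x\<in>C. (\<lambda>y. - x + y) -` W)"
      using \<open>0 \<in> W\<close> by (intro UN_I[of y]) simp_all
  qed
  ultimately show ?thesis by simp
qed

text \<open>
  The compactness argument. A coordinate function vanishing on \<open>W\<close> is constant on the cosets of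
  the open subspace \<open>W\<close>, so its level sets are closed linear varieties. The sum of finitely many
  basis vectors in \<open>E\<close> meets all the corresponding level sets of value 1; a point of all level sets
  would have infinitely many non-zero coordinates if \<open>E\<close> were infinite.
\<close>
lemma finite_coordinates_vanishing_on_open_subspace:
  fixes smul :: "'k::field \<Rightarrow> 'v::topological_ab_group_add \<Rightarrow> 'v"
  assumes vs: "vector_space smul" and lc: "linearly_compact smul U"
    and W: "module.subspace smul W" "open W" "W \<subseteq> U"
    and indep: "\<not> module.dependent smul B" and BU: "module.span smul B = U"
    and W0: "\<And>w b. w \<in> W \<Longrightarrow> b \<in> E \<Longrightarrow> module.representation smul B w b = 0"
    and E: "E \<subseteq> B"
  shows "finite E"
proof (rule ccontr)
  assume inf: "infinite E"
  interpret vector_space smul by fact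
  let ?r = "representation B"
  have indep: "independent B" by (rule indep)
  have sU: "subspace U" using lc by (simp add: linearly_compact_def)
  have EU: "e \<in> U" if "e \<in> E" for e using that E BU span_base by blast
  define C where "C e = {u \<in> U. ?r u e = 1}" for e
  have var: "closed_linear_variety smul U (C e)" if "e \<in> E" for e
  proof -
    let ?L = "{u \<in> U. ?r u e = 0}"
    have "subspace ?L"
      using indep BU sU
      by (auto simp: subspace_def representation_add representation_scale representation_zero)
    moreover have "C e = (+) e ` ?L"
    proof -
      have ee: "?r e e = 1" using that E indep by (simp add: representation_basis subset_iff)
      have "e + x \<in> C e" if "x \<in> ?L" for x
        using that ee EU[OF \<open>e \<in> E\<close>] subspace_add[OF sU]
        by (simp add: C_def representation_add[OF indep] BU)
      moreover have "x - e \<in> ?L" if "x \<in> C e" for x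
        using that ee EU[OF \<open>e \<in> E\<close>] subspace_diff[OF sU]
        by (simp add: C_def representation_diff[OF indep] BU)
      then have "x \<in> (+) e ` ?L" if "x \<in> C e" for x
        using that by (intro image_eqI[of _ _ "x - e"]) simp_all
      ultimately show ?thesis by blast
    qed
    moreover have "open (U - C e)" and "open U"
    proof -
      have 0: "0 \<in> W" using W(1) by (rule subspace_0)
      show "open U"
        by (rule open_if_add_stable[OF W(2) 0]) (use W(3) sU in \<open>auto intro: subspace_add\<close>)
      show "open (U - C e)"
      proof (rule open_if_add_stable[OF W(2) 0])
        fix x w assume xw: "x \<in> U - C e" "w \<in> W"
        then have "?r (x + w) e = ?r x e"
          using indep BU W(3) W0[OF _ that] by (subst representation_add) auto
        then show "x + w \<in> U - C e"
          using xw W(3) sU by (auto simp: C_def intro: subspace_add)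
      qed
    qed
    then have "closedin (top_of_set U) (C e)"
      by (auto simp: closedin_def openin_open_eq C_def)
    ultimately show ?thesis
      unfolding closed_linear_variety_def using EU[OF that]
      by (intro conjI bexI[of _ e] exI[of _ ?L]) simp_all
  qed
  have fip: "U \<inter> \<Inter>\<F> \<noteq> {}" if "finite \<F>" "\<F> \<subseteq> C ` E" for \<F>
  proof -
    obtain F where F: "finite F" "F \<subseteq> E" "\<F> = C ` F"
      using finite_subset_image \<open>finite \<F>\<close> \<open>\<F> \<subseteq> C ` E\<close> by metis
    have "?r (\<Sum>F) e = 1" if "e \<in> F" for e
    proof -
      have "?r (\<Sum>F) e = (\<Sum>b\<in>F. ?r b e)"
        by (subst representation_sum[OF indep]) (use F E span_base in auto)
      also have "\<dots> = (\<Sum>b\<in>F. if b = e then 1 else 0)"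
        by (rule sum.cong) (use F E indep in \<open>auto simp: representation_basis\<close>)
      also have "\<dots> = 1" using that \<open>finite F\<close> by simp
      finally show ?thesis .
    qed
    moreover have "\<Sum>F \<in> U" using sU F EU by (auto intro: subspace_sum)
    ultimately have "\<Sum>F \<in> U \<inter> \<Inter>\<F>" by (auto simp: F C_def)
    then show ?thesis by blast
  qed
  have "U \<inter> \<Inter>(C ` E) \<noteq> {}"
  proof -
    have "\<forall>\<C>. (\<forall>C\<in>\<C>. closed_linear_variety smul U C) \<and>
        (\<forall>\<F>. finite \<F> \<and> \<F> \<subseteq> \<C> \<longrightarrow> U \<inter> \<Inter>\<F> \<noteq> {}) \<longrightarrow> U \<inter> \<Inter>\<C> \<noteq> {}"
      using lc unfolding linearly_compact_def by (elim conjE)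
    then show ?thesis using var fip by simp
  qed
  then obtain u where "\<forall>e\<in>E. ?r u e = 1" by (auto simp: C_def)
  then have "E \<subseteq> {b. ?r u b \<noteq> 0}" by auto
  then show False using inf finite_representation[of B u] finite_subset by blast
qed

text \<open>
  Extend a basis \<open>B0\<close> of \<open>W\<close> to a basis \<open>B\<close> of \<open>U\<close>. The coordinates along the added vectors vanish
  on \<open>W\<close>, so only finitely many vectors were added, and their cosets form a basis of the quotient.
\<close>
lemma finite_quot_basis_linearly_compact_open:
  fixes smul :: "'k::field \<Rightarrow> 'v::topological_ab_group_add \<Rightarrow> 'v"
  assumes vs: "vector_space smul" and lc: "linearly_compact smul U"
    and W: "module.subspace smul W" "open W" "W \<subseteq> U"
  shows "\<exists>B. finite B \<and> quot_basis smul U W B"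
proof -
  interpret vector_space smul by fact
  have sU: "subspace U" using lc by (simp add: linearly_compact_def)
  obtain B0 where B0: "B0 \<subseteq> W" "independent B0" "W \<subseteq> span B0"
    using maximal_independent_subset by blast
  have spB0: "span B0 = W" using B0 W(1) by (intro span_subspace)
  obtain B where B: "B0 \<subseteq> B" "B \<subseteq> U" "independent B" "U \<subseteq> span B"
    using maximal_independent_subset_extend[of B0 U] B0 W(3) by blast
  have spB: "span B = U" using B sU by (intro span_subspace)
  define E where "E = B - B0"
  let ?r = "representation B"
  have rep0: "?r w e = 0" if "w \<in> W" "e \<in> E" for w e
  proof -
    have "?r w = representation B0 w"
      using that B B0 by (intro representation_extend) auto
    then show ?thesis using that(2) representation_ne_zero[of B0 w e] by (auto simp: E_def)
  qed
  have "finite E"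
    using finite_coordinates_vanishing_on_open_subspace[OF vs lc W B(3) spB rep0, of E]
    by (auto simp: E_def)
  have EU: "E \<subseteq> U" and EB: "E \<subseteq> B" using B by (auto simp: E_def)
  have repsum: "?r (\<Sum>A\<in>F. smul (c A) (g A)) (g A0) = c A0"
    if "finite F" "g ` F \<subseteq> E" "inj_on g F" "A0 \<in> F" for F :: "'v set set" and c g A0
  proof -
    have "?r (\<Sum>A\<in>F. smul (c A) (g A)) (g A0) = (\<Sum>A\<in>F. c A * ?r (g A) (g A0))"
      using that EB B(3)
      by (subst representation_sum)
        (auto intro!: sum.cong intro: span_scale span_base simp: representation_scale span_base subset_iff)
    also have "\<dots> = (\<Sum>A\<in>F. if A = A0 then c A else 0)"
      using that EB B(3)
      by (intro sum.cong) (auto simp: representation_basis subset_iff inj_on_eq_iff)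
    also have "\<dots> = c A0" using that by simp
    finally show ?thesis .
  qed
  \<comment> \<open>The quotient map on the added vectors; \<open>g\<close> below picks the representatives back.\<close>
  let ?q = "\<lambda>e. (+) e ` W"
  have cosetW: "x \<in> W" if "(+) x ` W = W" for x
    using that subspace_0[OF W(1)] by (metis add.right_neutral image_eqI)
  have coset_eq: "(+) x ` W = (+) y ` W" if "x - y \<in> W" for x y
  proof (intro set_eqI iffI)
    fix z assume "z \<in> (+) x ` W"
    then obtain w where "w \<in> W" "z = y + ((x - y) + w)" by auto
    then show "z \<in> (+) y ` W" using that W(1) subspace_add by blast
  next
    fix z assume "z \<in> (+) y ` W"
    then obtain w where "w \<in> W" "z = x + (w - (x - y))" by auto
    then show "z \<in> (+) x ` W" using that W(1) subspace_diff by blast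
  qed
  define g where "g = inv_into E ?q"
  have g: "g A \<in> E" "A = ?q (g A)" if "A \<in> ?q ` E" for A
    using inv_into_into[OF that] f_inv_into_f[OF that] by (auto simp: g_def)
  have ginj: "inj_on g (?q ` E)" unfolding g_def by (rule inj_on_inv_into) simp
  have lincomb: "quot_lincomb smul W F c = (+) (\<Sum>A\<in>F. smul (c A) (g A)) ` W"
    if "finite F" "F \<subseteq> ?q ` E" for F c
    by (rule quot_lincomb_coset[OF vs W(1) that(1)]) (use that(2) g in blast)
  have "quot_basis smul U W (?q ` E)"
    unfolding quot_basis_def
  proof (intro conjI allI impI ballI)
    show "?q ` E \<subseteq> quotient_space U W" using EU by (auto simp: quotient_space_def)
  next
    fix F c A0
    assume F: "finite F \<and> F \<subseteq> ?q ` E \<and> quot_lincomb smul W F c = W" and A0: "A0 \<in> F"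
    then have w: "(\<Sum>A\<in>F. smul (c A) (g A)) \<in> W" using lincomb cosetW by metis
    have "c A0 = ?r (\<Sum>A\<in>F. smul (c A) (g A)) (g A0)"
      by (rule repsum[symmetric]) (use F A0 g ginj in \<open>auto intro: inj_on_subset\<close>)
    also have "\<dots> = 0" using w by (rule rep0) (use F A0 g in auto)
    finally show "c A0 = 0" .
  next
    fix X assume "X \<in> quotient_space U W"
    then obtain u where u: "u \<in> U" "X = (+) u ` W" by (auto simp: quotient_space_def)
    have "u \<in> span (B0 \<union> E)" using u spB B(1) by (simp add: E_def Un_absorb1)
    then obtain w y where wy: "w \<in> W" "y \<in> span E" "u = w + y"
      unfolding span_Un spB0 by auto
    then obtain a where a: "y = (\<Sum>e\<in>E. smul (a e) e)"
      using span_finite[OF \<open>finite E\<close>] by auto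
    have qinj: "inj_on ?q E"
    proof (rule inj_onI, rule ccontr)
      fix e e' assume e: "e \<in> E" "e' \<in> E" "?q e = ?q e'" "e \<noteq> e'"
      have "e \<in> ?q e'" using e(3) subspace_0[OF W(1)] by (metis add.right_neutral image_eqI)
      then have "e - e' \<in> W" by auto
      then have "?r (e - e') e = 0" using e rep0 by auto
      moreover have "?r (e - e') e = 1"
        using e EB B(3) by (auto simp: representation_diff span_base representation_basis subset_iff)
      ultimately show False by simp
    qed
    have "(\<Sum>A\<in>?q ` E. smul (a (g A)) (g A)) = y"
      unfolding a sum.reindex[OF qinj]
      by (rule sum.cong) (simp_all add: g_def inv_into_f_f[OF qinj])
    then have "quot_lincomb smul W (?q ` E) (\<lambda>A. a (g A)) = (+) y ` W"
      using lincomb[of "?q ` E" "\<lambda>A. a (g A)"] \<open>finite E\<close> by simp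
    also have "\<dots> = X" unfolding u(2) by (rule coset_eq[symmetric]) (use wy in simp)
    finally show "\<exists>F c. finite F \<and> F \<subseteq> ?q ` E \<and> X = quot_lincomb smul W F c"
      using \<open>finite E\<close> by (intro exI[of _ "?q ` E"]) auto
  qed
  with \<open>finite E\<close> show ?thesis by blast
qed

text \<open>
  Since \<open>quot_dim\<close> is the cardinality of an arbitrarily chosen finite basis, it has to be shown that
  the empty set is the only basis of the zero space: its only possible member is the zero coset
  \<open>W\<close>, which is a non-trivial combination of itself equal to zero.
\<close>
lemma quot_dim_self:
  assumes vs: "vector_space smul" and W: "module.subspace smul W"
  shows "quot_dim smul W W = 0"
proof -
  interpret vector_space smul by fact
  have q: "quotient_space W W = {W}"
  proof -
    have "(+) u ` W = W" if "u \<in> W" for u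
    proof (intro set_eqI iffI)
      fix x assume "x \<in> W"
      then have "x - u \<in> W" using that W subspace_diff by blast
      then show "x \<in> (+) u ` W" by (intro image_eqI[of _ _ "x - u"]) auto
    qed (use that W subspace_add in auto)
    then show ?thesis using subspace_0[OF W] by (auto simp: quotient_space_def)
  qed
  have lc: "quot_lincomb smul W {W} (\<lambda>_. 1) = W"
    using quot_lincomb_coset[OF vs W, of "{W}" "\<lambda>_. 0" "\<lambda>_. 1"] by simp
  have "B = {}" if "quot_basis smul W W B" for B
  proof (rule ccontr)
    assume "B \<noteq> {}"
    with that q have "W \<in> B" by (auto simp: quot_basis_def)
    moreover have "\<forall>F c. finite F \<and> F \<subseteq> B \<and> quot_lincomb smul W F c = W \<longrightarrow> (\<forall>A\<in>F. c A = 0)"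
      using that unfolding quot_basis_def by (elim conjE)
    ultimately show False using lc by (metis empty_subsetI finite.emptyI finite.insertI insertI1
          insert_subset one_neq_zero)
  qed
  moreover have "quot_basis smul W W {}"
    unfolding quot_basis_def q by (auto simp: quot_lincomb_def intro!: exI[of _ "{}"])
  ultimately have ex: "\<exists>B. finite B \<and> quot_basis smul W W B"
    and some: "(SOME B. finite B \<and> quot_basis smul W W B) = {}"
    by (blast, metis (mono_tags, lifting) finite.emptyI someI)
  show ?thesis unfolding quot_dim_def some using ex by (simp add: zero_enat_def)
qed

lemma LCO_wedge_map_funpow: "(LCO_wedge_map f ^^ n) U = (\<Inter>k\<le>n. (f ^^ k) -` U)"
proof (induction n)
  case (Suc n)
  have "(\<Inter>k\<le>Suc n. (f ^^ k) -` U) = (\<Inter>k\<le>n. (f ^^ k) -` U) \<inter> f -` (\<Inter>k\<le>n. (f ^^ k) -` U)"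
  proof -
    have "(\<forall>k\<le>Suc n. (f ^^ k) x \<in> U) \<longleftrightarrow>
      (\<forall>k\<le>n. (f ^^ k) x \<in> U) \<and> (\<forall>k\<le>n. (f ^^ k) (f x) \<in> U)" for x
      by (metis funpow_swap1 funpow.simps(2) comp_apply le_SucI le_Suc_eq order_refl Suc_le_mono)
    then show ?thesis
      by (intro set_eqI) (simp only: INT_iff Int_iff vimage_eq Ball_def atMost_iff)
  qed
  then show ?case using Suc by (simp add: LCO_wedge_map_def)
qed simp

lemma LCO_wedge_trajectory:
  "trajectory (LCO_wedge smul) (LCO_wedge_map f) n U = (\<Inter>k<n. (f ^^ k) -` U)"
proof (induction n)
  case (Suc n)
  have "(\<Inter>k<n. (f ^^ k) -` U) \<inter> (\<Inter>k\<le>n. (f ^^ k) -` U) = (\<Inter>k<Suc n. (f ^^ k) -` U)"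
    by (auto simp: lessThan_Suc_atMost)
  then show ?case using Suc by (simp add: LCO_wedge_def LCO_wedge_map_funpow)
qed (simp add: LCO_wedge_def)

text \<open>
  The trajectory omits the preimage under the identity only for \<open>n = 0\<close>; as the distance is
  taken from \<open>U\<close>, it depends only on the intersection with \<open>U\<close>, so the two sequences agree at
  every \<open>n\<close>.
\<close>
lemma intrinsic_entropy_at_LCO_wedge:
  "intrinsic_entropy_at (LCO_wedge smul) (LCO_wedge_map f) U = ent_star_at smul f U"
proof -
  have "U \<inter> (\<Inter>k<n. (f ^^ k) -` U) = U \<inter> (\<Inter>k\<in>{1..<n}. (f ^^ k) -` U)" for n
  proof -
    have "{..<n} \<subseteq> insert 0 {1..<n}" "{1..<n} \<subseteq> {..<n}" by auto
    then show ?thesis by fastforce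
  qed
  then show ?thesis
    unfolding intrinsic_entropy_at_def ent_star_at_def LCO_wedge_trajectory
    by (simp add: LCO_wedge_def)
qed

theorem theorem5p12:
  fixes smul :: "'k::field \<Rightarrow> 'v::topological_ab_group_add \<Rightarrow> 'v"
    and f :: "'v \<Rightarrow> 'v"
  assumes "locally_linearly_compact smul"
    and "Vector_Spaces.linear smul smul f"
    and "continuous_on UNIV f"
  shows "ent_star smul f = intrinsic_entropy (LCO_wedge smul) (LCO_wedge_map f)"
proof -
  interpret Vector_Spaces.linear smul smul f by fact
  have vs: "vector_space smul" by unfold_locales
  have inert: "U \<in> inert_elems (LCO_wedge smul) (LCO_wedge_map f)" if U: "U \<in> LCO smul" for U
  proof -
    have lc: "linearly_compact smul U" and oU: "open U" using U by (auto simp: LCO_def)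
    then have sU: "vs1.subspace U" by (simp add: linearly_compact_def)
    have "vs1.subspace (U \<inter> f -` U)"
      using sU by (auto simp: vs1.subspace_def add scale zero)
    moreover have "open (U \<inter> f -` U)" using oU assms(3) by (simp add: open_Int open_vimage)
    ultimately have "\<exists>B. finite B \<and> quot_basis smul U (U \<inter> f -` U) B"
      using finite_quot_basis_linearly_compact_open[OF vs lc] by blast
    then have "ennreal_of_enat (quot_dim smul U (U \<inter> f -` U)) < \<infinity>"
      by (simp add: quot_dim_def of_nat_less_top)
    then show ?thesis
      using U by (simp add: inert_elems_def LCO_wedge_def LCO_wedge_map_def)
  qed
  have UNIV0: "ent_star_at smul f UNIV = 0"
    by (simp add: ent_star_at_def quot_dim_self[OF vs vs1.subspace_UNIV] lim_const)
  show ?thesis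
    unfolding ent_star_def intrinsic_entropy_def intrinsic_entropy_at_LCO_wedge
  proof (rule antisym)
    show "(SUP U\<in>LCO smul. ent_star_at smul f U)
      \<le> (SUP U\<in>inert_elems (LCO_wedge smul) (LCO_wedge_map f). ent_star_at smul f U)"
      using inert by (intro SUP_subset_mono) auto
    show "(SUP U\<in>inert_elems (LCO_wedge smul) (LCO_wedge_map f). ent_star_at smul f U)
      \<le> (SUP U\<in>LCO smul. ent_star_at smul f U)"
    proof (rule SUP_least)
      fix U assume "U \<in> inert_elems (LCO_wedge smul) (LCO_wedge_map f)"
      then have "U \<in> LCO smul \<or> U = UNIV" by (auto simp: inert_elems_def LCO_wedge_def)
      then show "ent_star_at smul f U \<le> (SUP U\<in>LCO smul. ent_star_at smul f U)"
        using UNIV0 by (auto intro: SUP_upper)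
    qed
  qed
qed

end
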